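(* Let $G$ be a graph on $n$ vertices containing no induced copy of $P_5$, and let $m:=\hom(G)$. If $m<n$, then there exist disjoint vertex sets $A,B \subseteq V(G)$ with $|A|,|B| \ge \frac{n}{m^{13}}$ such that there is no edge of $G$ between $A$ and $B$.
   Context: $P_5$ denotes the path on five vertices. A homogeneous set in $G$ is a set of vertices spanning a clique or an independent set, and $\hom(G)$ is the largest size of a homogeneous set in $G$. *)

theory Defs
  imports Complex_Main "HOL-Library.Ramsey"
begin

text \<open>A graph is a pair of a vertex set \<open>V\<close> and a set \<open>E\<close> of two-element subsets of \<open>V\<close>,
  the convention under which \<^const>\<open>clique\<close> and \<^const>\<open>indep\<close> are defined in
  \<^theory>\<open>HOL-Library.Ramsey\<close>.\<close>

definition finite_simple_graph :: "'a set \<Rightarrow> 'a set set \<Rightarrow> bool" where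
  "finite_simple_graph V E \<longleftrightarrow> finite V \<and> E \<subseteq> [V]\<^bsup>2\<^esup>"

definition contains_induced ::
    "'a set \<Rightarrow> 'a set set \<Rightarrow> 'b set \<Rightarrow> 'b set set \<Rightarrow> bool" where
  "contains_induced V E W F \<longleftrightarrow>
     (\<exists>f. inj_on f W \<and> f ` W \<subseteq> V \<and>
          (\<forall>u\<in>W. \<forall>v\<in>W. {f u, f v} \<in> E \<longleftrightarrow> {u, v} \<in> F))"

definition path_verts :: "nat \<Rightarrow> nat set" where
  "path_verts k = {..<k}"

definition path_edges :: "nat \<Rightarrow> nat set set" where
  "path_edges k = {{i, Suc i} | i. Suc i < k}"

definition homogeneous :: "'a set \<Rightarrow> 'a set set \<Rightarrow> bool" where
  "homogeneous S E \<longleftrightarrow> clique S E \<or> indep S E"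

definition hom_number :: "'a set \<Rightarrow> 'a set set \<Rightarrow> nat" where
  "hom_number V E = Max {card S | S. S \<subseteq> V \<and> homogeneous S E}"

end

theory Submission
  imports Defs
begin

text \<open>Suppose that no two anticomplete sets both have size at least \<open>t = n / m ^ 13\<close>. Then every large
  vertex set contains a connected subset missing fewer than \<open>t\<close> of its vertices. If \<open>v\<close> is adjacent
  to \<open>u\<close>, and \<open>S\<close> is such a connected subset of the common non-neighbours of \<open>u\<close> and \<open>v\<close>, then
  \<open>P\<^sub>5\<close>-freeness makes every neighbour of \<open>u\<close> outside the neighbourhood of \<open>v\<close> complete or anticomplete
  to \<open>S\<close>. Consequently, for all but few neighbours \<open>u\<close> of \<open>v\<close>, almost every vertex is adjacent to
  \<open>u\<close> or to \<open>v\<close>. So few triples of vertices induce exactly one edge, that is, the graph is close to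
  complete multipartite. Either many vertices have few non-neighbours, which gives a clique larger
  than \<open>m\<close>, or some vertex has many non-neighbours with few edges among them, which gives an
  independent set larger than \<open>m\<close>.\<close>

section \<open>Ramsey and greedy bounds for a symmetric relation\<close>

text \<open>One of the two classes into which a vertex \<open>x\<close> splits the other vertices
  has at least half the required size; \<open>x\<close> extends what induction finds there. This
  crude bound is enough, as it only serves to show \<open>6 \<le> m\<close>.\<close>

lemma ramsey_two_power:
  assumes "finite X" and "symp R" and "2 ^ (a + b) \<le> card X"
  shows "(\<exists>S\<subseteq>X. card S = a \<and> pairwise R S) \<or> (\<exists>S\<subseteq>X. card S = b \<and> pairwise (\<lambda>x y. \<not> R x y) S)"
  using assms(1,3)
proof (induction "a + b" arbitrary: a b X)
  case 0
  then show ?case by (intro disjI1 exI[of _ "{}"]) auto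
next
  case (Suc k)
  show ?case
  proof (cases "a = 0 \<or> b = 0")
    case True
    then show ?thesis by (metis card.empty empty_subsetI pairwise_empty)
  next
    case False
    then obtain a' b' where a': "a = Suc a'" and b': "b = Suc b'"
      by (meson not0_implies_Suc)
    have ks: "k = a' + b" "k = a + b'" using Suc.hyps(2) a' b' by auto
    from Suc.prems have "card X \<noteq> 0" by (metis le_zero_eq power_not_zero zero_neq_numeral)
    then obtain x where x: "x \<in> X" by fastforce
    define A where "A = {y \<in> X - {x}. R x y}"
    define B where "B = {y \<in> X - {x}. \<not> R x y}"
    have fin: "finite A" "finite B" using Suc.prems(1) by (auto simp: A_def B_def)
    have "X = insert x (A \<union> B)" "x \<notin> A \<union> B" "A \<inter> B = {}" using x by (auto simp: A_def B_def)
    then have "card X = Suc (card A + card B)"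
      using fin by (metis card_Un_disjoint card_insert_disjoint finite_UnI)
    moreover have "2 * 2 ^ k \<le> card X"
      using Suc.prems(2) Suc.hyps(2) by (metis power_Suc)
    \<comment> \<open>Removing \<open>x\<close> costs one element: the two cards add up to at least
      \<open>2 * 2 ^ k - 1\<close>, which still forces one of them, being integers, up to
      \<open>2 ^ k\<close>.\<close>
    ultimately consider "2 ^ k \<le> card A" | "2 ^ k \<le> card B" by linarith
    then show ?thesis
    proof cases
      case 1
      from Suc.hyps(1)[OF ks(1) fin(1)] 1 ks(1) consider
          S where "S \<subseteq> A" "card S = a'" "pairwise R S"
        | S where "S \<subseteq> A" "card S = b" "pairwise (\<lambda>x y. \<not> R x y) S"
        by auto
      then show ?thesis
      proof cases
        case (1 S)
        have "insert x S \<subseteq> X" using 1 x by (auto simp: A_def)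
        moreover have "card (insert x S) = a"
        proof -
          have "x \<notin> S" "finite S" using 1 fin finite_subset by (auto simp: A_def)
          then show ?thesis using 1 a' by simp
        qed
        moreover have "pairwise R (insert x S)"
          using 1 assms(2) by (auto simp: pairwise_insert A_def symp_def)
        ultimately show ?thesis by blast
      next
        case (2 S)
        then show ?thesis by (auto simp: A_def)
      qed
    next
      case 2
      from Suc.hyps(1)[OF ks(2) fin(2)] 2 ks(2) consider
          S where "S \<subseteq> B" "card S = a" "pairwise R S"
        | S where "S \<subseteq> B" "card S = b'" "pairwise (\<lambda>x y. \<not> R x y) S"
        by auto
      then show ?thesis
      proof cases
        case (1 S)
        then show ?thesis by (auto simp: B_def)
      next
        case (2 S)
        have "insert x S \<subseteq> X" using 2 x by (auto simp: B_def)
        moreover have "card (insert x S) = b"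
        proof -
          have "x \<notin> S" "finite S" using 2 fin finite_subset by (auto simp: B_def)
          then show ?thesis using 2 b' by simp
        qed
        moreover have "pairwise (\<lambda>x y. \<not> R x y) (insert x S)"
          using 2 assms(2) by (auto simp: pairwise_insert B_def symp_def)
        ultimately show ?thesis by blast
      qed
    qed
  qed
qed

text \<open>Each greedy choice discards the chosen element and its at most \<open>d\<close>
  relatives. After \<open>k\<close> choices an element is left over, hence
  \<open>Suc k\<close>.\<close>

lemma greedy_independent_set:
  fixes d :: real
  assumes "finite X" and "symp R" and "0 \<le> d" and "\<And>x. x \<in> X \<Longrightarrow> real (card {y \<in> X. R x y}) \<le> d"
    and "real (card X) > real k * (d + 1)"
  shows "\<exists>S\<subseteq>X. card S = Suc k \<and> pairwise (\<lambda>x y. \<not> R x y) S"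
  using assms(1,4,5)
proof (induction k arbitrary: X)
  case 0
  then have "X \<noteq> {}" by auto
  then obtain x where "x \<in> X" by auto
  then show ?case by (intro exI[of _ "{x}"]) auto
next
  case (Suc k)
  have "0 \<le> real (Suc k) * (d + 1)" using assms(3) by simp
  then have "X \<noteq> {}" using Suc.prems(3) by auto
  then obtain x where x: "x \<in> X" by auto
  define Y where "Y = X - insert x {y \<in> X. R x y}"
  have "X = insert x {y \<in> X. R x y} \<union> Y" using x by (auto simp: Y_def)
  then have "card X \<le> card (insert x {y \<in> X. R x y}) + card Y"
    by (metis card_Un_le)
  moreover have "real (card (insert x {y \<in> X. R x y})) \<le> d + 1"
    using Suc.prems(2)[OF x] Suc.prems(1) by (auto simp: card_insert_if)
  ultimately have "real (card Y) > real k * (d + 1)"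
    using Suc.prems(3) by (simp add: algebra_simps)
  moreover have "real (card {z \<in> Y. R y z}) \<le> d" if "y \<in> Y" for y
  proof -
    have "card {z \<in> Y. R y z} \<le> card {z \<in> X. R y z}"
      using Suc.prems(1) by (intro card_mono) (auto simp: Y_def)
    then show ?thesis using Suc.prems(2)[of y] that by (simp add: Y_def)
  qed
  ultimately obtain S where S: "S \<subseteq> Y" "card S = Suc k" "pairwise (\<lambda>x y. \<not> R x y) S"
    using Suc.IH[of Y] Suc.prems(1) by (auto simp: Y_def)
  have fS: "finite S" using S by (metis card.infinite nat.distinct(1))
  have "x \<notin> S" using S by (auto simp: Y_def)
  then have "card (insert x S) = Suc (Suc k)" using S fS by simp
  moreover have "pairwise (\<lambda>x y. \<not> R x y) (insert x S)"
    using S assms(2) by (auto simp: pairwise_insert Y_def symp_def)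
  moreover have "insert x S \<subseteq> X" using S x by (auto simp: Y_def)
  ultimately show ?case by blast
qed

section \<open>The hypothetical counterexample and its basic estimates\<close>

text \<open>The negated theorem, with \<open>t\<close> standing for \<open>n / m ^ 13\<close>.
  Keeping \<open>t\<close> free confines the exponent to \<open>card_lt\<close>.\<close>

locale counterexample =
  fixes V :: "'a set" and adj :: "'a \<Rightarrow> 'a \<Rightarrow> bool" and m :: nat and t :: real
  assumes fin_V: "finite V"
    and adj_sym: "adj u v \<Longrightarrow> adj v u"
    and adj_irrefl: "\<not> adj v v"
    \<comment> \<open>Distinctness of the five vertices is implied when all the non-adjacencies hold.\<close>
    and P5_free: "\<lbrakk>a \<in> V; b \<in> V; c \<in> V; d \<in> V; e \<in> V; adj a b; adj b c; adj c d; adj d e\<rbrakk>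
      \<Longrightarrow> adj a c \<or> adj a d \<or> adj a e \<or> adj b d \<or> adj b e \<or> adj c e"
    and clique_le: "\<lbrakk>S \<subseteq> V; pairwise adj S\<rbrakk> \<Longrightarrow> card S \<le> m"
    and indep_le: "\<lbrakk>S \<subseteq> V; pairwise (\<lambda>x y. \<not> adj x y) S\<rbrakk> \<Longrightarrow> card S \<le> m"
    and t_ge_1: "1 \<le> t"
    and m_ge_1: "1 \<le> m"
    and no_pair: "\<lbrakk>A \<subseteq> V; B \<subseteq> V; A \<inter> B = {}; \<And>a b. \<lbrakk>a \<in> A; b \<in> B\<rbrakk> \<Longrightarrow> \<not> adj a b\<rbrakk>
      \<Longrightarrow> real (card A) < t \<or> real (card B) < t"
begin

definition N :: "'a \<Rightarrow> 'a set" where "N v = {w \<in> V. adj v w}"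

definition M :: "'a \<Rightarrow> 'a set" where "M v = {w \<in> V. w \<noteq> v \<and> \<not> adj v w}"

text \<open>Connectivity is phrased by cuts rather than walks: a set that splits \<open>D\<close>
  properly immediately yields an edge across the split.\<close>

definition connected_on :: "'a set \<Rightarrow> bool" where
  "connected_on D \<longleftrightarrow> (\<forall>A\<subseteq>D. A \<noteq> {} \<longrightarrow> A \<noteq> D \<longrightarrow> (\<exists>a\<in>A. \<exists>b\<in>D - A. adj a b))"

lemma finite_subset_V: "X \<subseteq> V \<Longrightarrow> finite X"
  using fin_V finite_subset by blast

lemma N_subset: "N v \<subseteq> V" and M_subset: "M v \<subseteq> V"
  by (auto simp: N_def M_def)

lemma mem_M_commute: "v \<in> V \<Longrightarrow> w \<in> V \<Longrightarrow> w \<in> M v \<longleftrightarrow> v \<in> M w"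
  by (auto simp: M_def dest: adj_sym)

lemma card_Diff_ge: "X \<subseteq> V \<Longrightarrow> real (card X) - real (card (X \<inter> Y)) = real (card (X - Y))"
  using finite_subset_V[of X] card_Diff_subset_Int[of X Y] card_mono[of X "X \<inter> Y"]
  by (simp add: of_nat_diff)

text \<open>Otherwise the greedy choice reaches an independent set of \<open>m + 1\<close>
  vertices.\<close>

lemma few_of_small_degree:
  assumes "X \<subseteq> V" and "0 \<le> d" and "\<And>x. x \<in> X \<Longrightarrow> real (card (X \<inter> N x)) \<le> d"
  shows "real (card X) \<le> real m * (d + 1)"
proof (rule ccontr)
  assume "\<not> ?thesis"
  moreover have "{y \<in> X. adj x y} = X \<inter> N x" for x
    using assms(1) by (auto simp: N_def)
  ultimately obtain S where "S \<subseteq> X" "card S = Suc m" "pairwise (\<lambda>x y. \<not> adj x y) S"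
    using greedy_independent_set[of X adj d m] assms finite_subset_V adj_sym
    by (auto simp: symp_def not_le)
  then show False using indep_le[of S] assms(1) by auto
qed

text \<open>The same argument in the complement, where the greedy choice builds a clique.\<close>

lemma few_of_small_codegree:
  assumes "X \<subseteq> V" and "0 \<le> d" and "\<And>x. x \<in> X \<Longrightarrow> real (card (X \<inter> M x)) \<le> d"
  shows "real (card X) \<le> real m * (d + 1)"
proof (rule ccontr)
  assume "\<not> ?thesis"
  moreover have "{y \<in> X. y \<noteq> x \<and> \<not> adj x y} = X \<inter> M x" for x
    using assms(1) by (auto simp: M_def)
  moreover have "symp (\<lambda>x y. y \<noteq> x \<and> \<not> adj x y)"
    using adj_sym by (auto simp: symp_def)
  ultimately obtain S where "S \<subseteq> X" "card S = Suc m" "pairwise (\<lambda>x y. \<not> (y \<noteq> x \<and> \<not> adj x y)) S"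
    using greedy_independent_set[of X "\<lambda>x y. y \<noteq> x \<and> \<not> adj x y" d m] assms finite_subset_V
    by (auto simp: not_le)
  then show False using clique_le[of S] assms(1) by (auto simp: pairwise_def)
qed

section \<open>Large connected sets and induced paths\<close>

text \<open>Among the unions of components of \<open>U\<close> that miss fewer than \<open>t\<close>
  vertices, a smallest one \<open>D\<close> is connected: if it split into two parts without edges
  between them, each part would have fewer than \<open>t\<close> vertices, so \<open>U\<close> would
  have fewer than \<open>3 * t\<close>.\<close>

lemma giant_component:
  assumes "U \<subseteq> V" and "3 * t \<le> real (card U)"
  obtains D where "D \<subseteq> U" "connected_on D" "real (card (U - D)) < t"
proof -
  define C where "C D \<longleftrightarrow> D \<subseteq> U \<and> (\<forall>a\<in>D. \<forall>b\<in>U - D. \<not> adj a b) \<and> real (card (U - D)) < t" for D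
  have "C U" using t_ge_1 by (auto simp: C_def)
  then obtain D where D: "C D" and min: "\<And>D'. C D' \<Longrightarrow> card D \<le> card D'"
    using ex_has_least_nat[of C U card] by blast
  have fU: "finite U" using finite_subset_V[OF assms(1)] .
  then have fD: "finite D" using D by (auto simp: C_def intro: finite_subset)
  have "connected_on D"
    unfolding connected_on_def
  proof (intro allI impI, rule ccontr)
    fix A assume A: "A \<subseteq> D" "A \<noteq> {}" "A \<noteq> D" and "\<not> (\<exists>a\<in>A. \<exists>b\<in>D - A. adj a b)"
    then have sep: "\<not> adj a b" "\<not> adj b a" if "a \<in> A" "b \<in> D - A" for a b
      using that adj_sym by blast+
    \<comment> \<open>\<open>X\<close> has no edges to the rest of \<open>U\<close>, so by
      minimality of \<open>D\<close> it misses at least \<open>t\<close> vertices;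
      \<open>no_pair\<close> then makes \<open>X\<close> itself small.\<close>
    have small: "real (card X) < t"
      if X: "X \<subset> D" and cl: "\<And>a b. a \<in> X \<Longrightarrow> b \<in> D - X \<Longrightarrow> \<not> adj a b" for X
    proof -
      have closed: "\<not> adj a b" if "a \<in> X" "b \<in> U - X" for a b
        using that X cl D unfolding C_def by (cases "b \<in> D") blast+
      have "card X < card D" using X fD by (simp add: psubset_card_mono)
      then have "\<not> C X" using min leD by blast
      then have "\<not> real (card (U - X)) < t" using closed X D by (auto simp: C_def)
      then show ?thesis
        using no_pair[of X "U - X"] closed X D assms(1) unfolding C_def by blast
    qed
    have "real (card A) < t" using small[of A] A sep by blast
    moreover have "real (card (D - A)) < t" using small[of "D - A"] A sep by blast
    moreover have "card U = card A + card (D - A) + card (U - D)"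
      using D A fU fD by (metis C_def card_Diff_subset card_mono finite_subset le_add_diff_inverse2 add.commute)
    ultimately show False using D assms(2) by (simp add: C_def)
  qed
  then show ?thesis using that D by (auto simp: C_def)
qed

text \<open>If \<open>D\<close> were mixed to \<open>x\<close>, connectedness would give an edge
  \<open>a b\<close> in \<open>D\<close> with only \<open>a\<close> adjacent to \<open>x\<close>,
  and \<open>v u x a b\<close> would be an induced path.\<close>

lemma complete_or_anticomplete:
  assumes "v \<in> V" "u \<in> V" "x \<in> V" "adj v u" "adj u x" "\<not> adj v x"
    and "D \<subseteq> M u \<inter> M v" "connected_on D"
  shows "D \<subseteq> N x \<or> D \<inter> N x = {}"
proof (rule ccontr)
  assume "\<not> ?thesis"
  then have "D \<inter> N x \<noteq> {}" "D \<inter> N x \<noteq> D" by auto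
  then obtain a b where "a \<in> D" "a \<in> N x" "b \<in> D" "b \<notin> N x" "adj a b"
    using assms(8) unfolding connected_on_def by (metis Diff_iff IntE IntI inf_le1)
  moreover have "\<not> adj u a" "\<not> adj u b" "\<not> adj v a" "\<not> adj v b" "a \<in> V" "b \<in> V"
    using assms(7) calculation by (auto simp: M_def)
  ultimately show False
    using P5_free[of v u x a b] assms by (auto simp: N_def)
qed

text \<open>Every neighbour in \<open>K\<close> of some \<open>u \<in> J\<close> has at most \<open>2 t\<close> neighbours or at most \<open>2 t\<close>
  non-neighbours in \<open>K\<close>. There are few such vertices, and \<open>J\<close> is anticomplete to the rest of \<open>K\<close>.\<close>

lemma sparse_pair:
  assumes v: "v \<in> V" and K: "K \<subseteq> M v" and J: "J \<subseteq> N v"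
    and deg: "\<And>u. u \<in> J \<Longrightarrow> real (card (K \<inter> N u)) < t"
    and big: "7 * real m * t \<le> real (card K)"
  shows "real (card J) < t"
proof -
  define X1 where "X1 = {x \<in> K. real (card (K \<inter> M x)) \<le> 2 * t}"
  define X2 where "X2 = {x \<in> K. real (card (K \<inter> N x)) \<le> 2 * t}"
  have KV: "K \<subseteq> V" and JV: "J \<subseteq> V" using K J M_subset N_subset by blast+
  have fK: "finite K" using finite_subset_V KV .
  have mt: "t \<le> real m * t" "real m \<le> real m * t"
    using m_ge_1 t_ge_1 by (simp_all add: mult_le_cancel_right1)
  have "real (card (X1 \<inter> M x)) \<le> 2 * t" if "x \<in> X1" for x
    using that card_mono[of "K \<inter> M x" "X1 \<inter> M x"] fK by (force simp: X1_def)
  then have c1: "real (card X1) \<le> real m * (2 * t + 1)"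
    using KV by (intro few_of_small_codegree) (use t_ge_1 in \<open>auto simp: X1_def\<close>)
  have "real (card (X2 \<inter> N x)) \<le> 2 * t" if "x \<in> X2" for x
    using that card_mono[of "K \<inter> N x" "X2 \<inter> N x"] fK by (force simp: X2_def)
  then have c2: "real (card X2) \<le> real m * (2 * t + 1)"
    using KV by (intro few_of_small_degree) (use t_ge_1 in \<open>auto simp: X2_def\<close>)
  have nbrs: "K \<inter> N u \<subseteq> X1 \<union> X2" if u: "u \<in> J" for u
  proof
    fix x assume x: "x \<in> K \<inter> N u"
    have cU: "real (card (K - N u)) > real (card K) - t"
      using card_Diff_ge[OF KV, of "N u"] deg[OF u] by simp
    have "3 * t \<le> real (card (K - N u))" using cU big mt by linarith
    then obtain D where D: "D \<subseteq> K - N u" "connected_on D" "real (card ((K - N u) - D)) < t"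
      using giant_component[of "K - N u"] KV by blast
    have "K - D = (K \<inter> N u) \<union> ((K - N u) - D)" using D by auto
    then have "real (card (K - D)) \<le> real (card (K \<inter> N u)) + real (card ((K - N u) - D))"
      by (metis card_Un_le of_nat_add of_nat_le_iff)
    then have KD: "real (card (K - D)) \<le> 2 * t" using D(3) deg[OF u] by linarith
    have "adj v u" "u \<in> V" using u J by (auto simp: N_def)
    moreover have "D \<subseteq> M u \<inter> M v"
      using D K KV calculation by (auto simp: M_def N_def dest: adj_sym)
    moreover have "\<not> adj v x" "x \<in> V" "adj u x" using x K by (auto simp: M_def N_def)
    ultimately consider "D \<subseteq> N x" | "D \<inter> N x = {}"
      using complete_or_anticomplete[of v u x D] v D(2) by blast
    then show "x \<in> X1 \<union> X2"
    proof cases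
      case 1
      then have "K \<inter> M x \<subseteq> K - D" by (auto simp: M_def N_def)
      then have "real (card (K \<inter> M x)) \<le> 2 * t"
        using KD card_mono[of "K - D" "K \<inter> M x"] fK by simp
      then show ?thesis using x by (simp add: X1_def)
    next
      case 2
      then have "K \<inter> N x \<subseteq> K - D" by auto
      then have "real (card (K \<inter> N x)) \<le> 2 * t"
        using KD card_mono[of "K - D" "K \<inter> N x"] fK by simp
      then show ?thesis using x by (simp add: X2_def)
    qed
  qed
  \<comment> \<open>The constant 7: \<open>X1\<close> and \<open>X2\<close> together have at most
    \<open>2 * m * (2 * t + 1) \<le> 6 * m * t\<close> elements, so at least
    \<open>m * t \<ge> t\<close> vertices of \<open>K\<close> remain.\<close>
  let ?R = "K - (X1 \<union> X2)"
  have "X1 \<union> X2 \<subseteq> K" by (auto simp: X1_def X2_def)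
  then have "real (card (K \<inter> (X1 \<union> X2))) \<le> real (card X1) + real (card X2)"
    using card_Un_le[of X1 X2] by (simp add: Int_absorb1)
  then have "real (card ?R) \<ge> real (card K) - 2 * (real m * (2 * t + 1))"
    using card_Diff_ge[OF KV, of "X1 \<union> X2"] c1 c2 by linarith
  moreover have "2 * (real m * (2 * t + 1)) = 4 * (real m * t) + 2 * real m"
    by (simp add: algebra_simps)
  ultimately have "t \<le> real (card ?R)" using big mt by linarith
  moreover have "\<not> adj a b" if "a \<in> J" "b \<in> ?R" for a b
    using nbrs[OF that(1)] that KV by (auto simp: N_def)
  moreover have "J \<inter> ?R = {}" using J K by (auto simp: N_def M_def)
  ultimately show ?thesis using no_pair[of J ?R] JV KV by fastforce
qed

text \<open>If \<open>w\<close> lies in the large connected part \<open>S u\<close> of \<open>M u \<inter> M v\<close>, then the neighbours of \<open>u\<close> in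
  \<open>M v \<inter> M w\<close> are anticomplete to \<open>S u\<close>, so they are few. By \<open>sparse_pair\<close> few \<open>u\<close> share the same \<open>w\<close>,
  and the bound follows by double counting the pairs \<open>(u, w)\<close>.\<close>

lemma few_large_common_codegree:
  assumes v: "v \<in> V" and q: "0 \<le> q"
  defines "N0 \<equiv> {u \<in> N v. q + 9 * real m ^ 2 * t \<le> real (card (M u \<inter> M v))}"
  shows "q * real (card N0) \<le> real (card V) * t"
proof -
  let ?\<kappa> = "7 * real m * t"
  \<comment> \<open>\<open>W\<close> collects the \<open>w\<close> for which
    \<open>M v \<inter> M w\<close> may be too small for \<open>sparse_pair\<close>. It has at most
    \<open>m * (7 * m * t + 1) \<le> 8 * m ^ 2 * t\<close> elements; with the fewer than
    \<open>t\<close> vertices lost in \<open>giant_component\<close> this explains the 9 in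
    \<open>N0\<close>.\<close>
  define W where "W = {w \<in> M v. real (card (M v \<inter> M w)) \<le> ?\<kappa>}"
  have fW: "finite W" using finite_subset_V[OF M_subset, of v] by (simp add: W_def)
  have fN0: "finite N0" using finite_subset_V[OF N_subset, of v] by (simp add: N0_def)
  have mt: "t \<le> real m * t" "real m \<le> real m * t" "real m * t \<le> real m ^ 2 * t" "0 \<le> t"
    using m_ge_1 t_ge_1 by (simp_all add: mult_le_cancel_right1 power2_eq_square)
  have "real (card (W \<inter> M w)) \<le> ?\<kappa>" if "w \<in> W" for w
    using that card_mono[of "M v \<inter> M w" "W \<inter> M w"] finite_subset_V[OF M_subset, of v]
    by (force simp: W_def)
  then have "real (card W) \<le> real m * (?\<kappa> + 1)"
    using M_subset by (intro few_of_small_codegree) (use t_ge_1 in \<open>auto simp: W_def\<close>)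
  also have "\<dots> = 7 * (real m ^ 2 * t) + real m" by (simp add: algebra_simps power2_eq_square)
  finally have cW: "real (card W) \<le> 8 * (real m ^ 2 * t)" using mt by linarith
  have "\<exists>S. S \<subseteq> M u \<inter> M v \<and> connected_on S \<and> q \<le> real (card (S - W)) \<and> t \<le> real (card S)"
    if u: "u \<in> N0" for u
  proof -
    let ?G = "M u \<inter> M v"
    have GV: "?G \<subseteq> V" using M_subset by blast
    have c: "q + 9 * (real m ^ 2 * t) \<le> real (card ?G)"
      using u by (simp add: N0_def mult.assoc)
    then have "3 * t \<le> real (card ?G)" using mt q by linarith
    then obtain S where S: "S \<subseteq> ?G" "connected_on S" "real (card (?G - S)) < t"
      using giant_component[OF GV] by blast
    have "real (card ?G) - real (card S) = real (card (?G - S))"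
      using card_Diff_ge[OF GV, of S] S(1) by (simp add: Int_absorb1)
    then have cS: "real (card ?G) - t < real (card S)" using S(3) by linarith
    have "real (card (S \<inter> W)) \<le> real (card W)" using fW by (simp add: card_mono)
    then have "real (card S) - real (card W) \<le> real (card (S - W))"
      using card_Diff_ge[of S W] S(1) GV by force
    then have "q \<le> real (card (S - W))" using cS c cW mt by linarith
    moreover have "t \<le> real (card S)" using cS c mt q by linarith
    ultimately show ?thesis using S by blast
  qed
  then obtain S where S: "\<And>u. u \<in> N0 \<Longrightarrow> S u \<subseteq> M u \<inter> M v \<and> connected_on (S u)
      \<and> q \<le> real (card (S u - W)) \<and> t \<le> real (card (S u))"
    by metis
  have J: "real (card {u \<in> N0. w \<in> S u}) \<le> t" if w: "w \<in> M v - W" for w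
  proof -
    define K where "K = M v \<inter> M w"
    have "real (card (K \<inter> N u)) < t" if u: "u \<in> N0" "w \<in> S u" for u
    proof -
      have uv: "adj v u" "u \<in> V" using u by (auto simp: N0_def N_def)
      \<comment> \<open>The vertex \<open>w\<close> of \<open>S u\<close> is not adjacent to
        \<open>x\<close>, so \<open>S u\<close> cannot be complete to \<open>x\<close>.\<close>
      have "S u \<inter> N x = {}" if x: "x \<in> K \<inter> N u" for x
      proof -
        have "\<not> adj v x" "x \<in> V" "adj u x" using x by (auto simp: K_def M_def N_def)
        moreover have "w \<notin> N x" using x by (auto simp: K_def M_def N_def dest: adj_sym)
        ultimately show ?thesis
          using complete_or_anticomplete[of v u x "S u"] S[OF u(1)] v uv u(2) by blast
      qed
      moreover have "(K \<inter> N u) \<inter> S u = {}" using S[OF u(1)] by (auto simp: M_def N_def)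
      moreover have "S u \<subseteq> V" using S[OF u(1)] M_subset by blast
      ultimately have "real (card (K \<inter> N u)) < t \<or> real (card (S u)) < t"
        using N_subset by (intro no_pair) (auto simp: N_def)
      then show ?thesis using S[OF u(1)] by linarith
    qed
    moreover have "?\<kappa> \<le> real (card K)" using w by (auto simp: W_def K_def)
    ultimately show ?thesis
      using sparse_pair[OF v, of K "{u \<in> N0. w \<in> S u}"] by (force simp: K_def N0_def)
  qed
  have "q * real (card N0) = (\<Sum>u\<in>N0. q)" by simp
  also have "\<dots> \<le> (\<Sum>u\<in>N0. real (card (S u - W)))" using S by (intro sum_mono) blast
  also have "\<dots> = (\<Sum>u\<in>N0. \<Sum>w\<in>M v - W. of_bool (w \<in> S u))"
  proof (rule sum.cong)
    fix u assume "u \<in> N0"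
    then have "S u - W = {w \<in> M v - W. w \<in> S u}" using S by blast
    then show "real (card (S u - W)) = (\<Sum>w\<in>M v - W. of_bool (w \<in> S u))"
      using finite_subset_V[OF M_subset, of v] by (simp add: sum.If_cases of_bool_def Int_def)
  qed simp
  also have "\<dots> = (\<Sum>w\<in>M v - W. \<Sum>u\<in>N0. of_bool (w \<in> S u))" by (rule sum.swap)
  also have "\<dots> = (\<Sum>w\<in>M v - W. real (card {u \<in> N0. w \<in> S u}))"
    using fN0 by (simp add: sum.If_cases of_bool_def Int_def)
  also have "\<dots> \<le> (\<Sum>w\<in>M v - W. t)" using J by (rule sum_mono)
  also have "\<dots> \<le> real (card V) * t"
  proof -
    have "card (M v - W) \<le> card V" using M_subset by (intro card_mono fin_V) blast
    then show ?thesis using mt by (simp add: mult_right_mono)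
  qed
  finally show ?thesis .
qed

section \<open>Counting edges inside non-neighbourhoods\<close>

text \<open>Every edge inside \<open>M x\<close> is counted twice, once from each end.\<close>

definition M_edges :: "'a \<Rightarrow> real" where
  "M_edges x = (\<Sum>y\<in>M x. real (card (M x \<inter> N y)))"

text \<open>The sum counts triples in which \<open>y z\<close> is an edge and \<open>x\<close> is
  adjacent to neither end. Regrouped by \<open>y\<close>, at most \<open>n * t / q\<close>
  exceptional \<open>z\<close> admit up to \<open>n\<close> choices of \<open>x\<close>
  (\<open>few_large_common_codegree\<close>), and every other \<open>z\<close> admits at most
  \<open>q + 9 * m ^ 2 * t\<close>; here \<open>n = card V\<close>.\<close>

lemma sum_M_edges_le:
  assumes q: "0 < q"
  shows "(\<Sum>x\<in>V. M_edges x) \<le> real (card V) ^ 2 * (real (card V) * t / q + (q + 9 * real m ^ 2 * t))"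
proof -
  let ?n = "real (card V)" and ?s = "q + 9 * real m ^ 2 * t"
  have s0: "0 \<le> ?s" using q t_ge_1 by simp
  have fM: "finite (M x)" for x using finite_subset_V M_subset by auto
  have "(\<Sum>x\<in>V. M_edges x) = (\<Sum>x\<in>V. \<Sum>y\<in>V. \<Sum>z\<in>V. of_bool (y \<in> M x \<and> z \<in> M x \<and> z \<in> N y))"
  proof (rule sum.cong)
    fix x
    have "M_edges x = (\<Sum>y\<in>V. if y \<in> M x then real (card (M x \<inter> N y)) else 0)"
      unfolding M_edges_def using fin_V M_subset[of x]
      by (simp add: sum.If_cases Int_absorb1)
    also have "\<dots> = (\<Sum>y\<in>V. \<Sum>z\<in>V. of_bool (y \<in> M x \<and> z \<in> M x \<and> z \<in> N y))"
    proof (rule sum.cong)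
      fix y
      have "V \<inter> {z. z \<in> M x \<and> z \<in> N y} = M x \<inter> N y" using M_subset by auto
      then show "(if y \<in> M x then real (card (M x \<inter> N y)) else 0)
          = (\<Sum>z\<in>V. of_bool (y \<in> M x \<and> z \<in> M x \<and> z \<in> N y))"
        using fin_V by (simp add: of_bool_def sum.If_cases)
    qed simp
    finally show "M_edges x = (\<Sum>y\<in>V. \<Sum>z\<in>V. of_bool (y \<in> M x \<and> z \<in> M x \<and> z \<in> N y))" .
  qed simp
  also have "\<dots> = (\<Sum>y\<in>V. \<Sum>x\<in>V. \<Sum>z\<in>V. of_bool (y \<in> M x \<and> z \<in> M x \<and> z \<in> N y))"
    by (rule sum.swap)
  also have "\<dots> = (\<Sum>y\<in>V. \<Sum>z\<in>V. \<Sum>x\<in>V. of_bool (y \<in> M x \<and> z \<in> M x \<and> z \<in> N y))"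
    by (intro sum.cong sum.swap refl)
  also have "\<dots> \<le> (\<Sum>y\<in>V. ?n * (?n * t / q + ?s))"
  proof (rule sum_mono)
    fix y assume y: "y \<in> V"
    let ?N0 = "{z \<in> N y. ?s \<le> real (card (M z \<inter> M y))}"
    have "real (card ?N0) \<le> ?n * t / q"
      using few_large_common_codegree[OF y, of q] q by (simp add: field_simps)
    then have N0: "real (card ?N0) * ?n \<le> ?n * t / q * ?n"
      by (intro mult_right_mono) auto
    have "(\<Sum>z\<in>V. \<Sum>x\<in>V. of_bool (y \<in> M x \<and> z \<in> M x \<and> z \<in> N y))
        \<le> (\<Sum>z\<in>V. of_bool (z \<in> ?N0) * ?n + ?s)"
    proof (rule sum_mono)
      fix z assume z: "z \<in> V"
      have le: "(\<Sum>x\<in>V. of_bool (y \<in> M x \<and> z \<in> M x \<and> z \<in> N y)) \<le> real (card (M z \<inter> M y))"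
      proof -
        have "V \<inter> {x. y \<in> M x \<and> z \<in> M x \<and> z \<in> N y} \<subseteq> M z \<inter> M y"
          using mem_M_commute y z by auto
        then show ?thesis
          using fin_V fM by (simp add: of_bool_def sum.If_cases card_mono)
      qed
      show "(\<Sum>x\<in>V. of_bool (y \<in> M x \<and> z \<in> M x \<and> z \<in> N y)) \<le> of_bool (z \<in> ?N0) * ?n + ?s"
      proof (cases "z \<in> N y")
        case False
        then show ?thesis using s0 by simp
      next
        case True
        have "card (M z \<inter> M y) \<le> card V" using fin_V M_subset by (intro card_mono) auto
        then show ?thesis using le True s0 by (auto simp: of_bool_def)
      qed
    qed
    also have "\<dots> = real (card ?N0) * ?n + ?n * ?s"
    proof -
      have "V \<inter> ?N0 = ?N0" using N_subset by auto
      then have "(\<Sum>z\<in>V. of_bool (z \<in> ?N0) :: real) = real (card ?N0)"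
        using fin_V by (simp add: of_bool_def sum.If_cases Int_def)
      then show ?thesis by (simp add: sum.distrib flip: sum_distrib_right)
    qed
    also have "\<dots> \<le> ?n * (?n * t / q + ?s)" using N0 by (simp add: algebra_simps)
    finally show "(\<Sum>z\<in>V. \<Sum>x\<in>V. of_bool (y \<in> M x \<and> z \<in> M x \<and> z \<in> N y)) \<le> ?n * (?n * t / q + ?s)" .
  qed
  also have "\<dots> = ?n ^ 2 * (?n * t / q + ?s)" by (simp add: power2_eq_square)
  finally show ?thesis .
qed

text \<open>The first term bounds the vertices of \<open>M x\<close> with more than \<open>d\<close>
  neighbours in \<open>M x\<close>; the rest fall under \<open>few_of_small_degree\<close>.\<close>

lemma card_M_le:
  assumes d: "0 < d"
  shows "real (card (M x)) \<le> M_edges x / d + real m * (d + 1)"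
proof -
  define L where "L = {y \<in> M x. d < real (card (M x \<inter> N y))}"
  have fM: "finite (M x)" using finite_subset_V M_subset by auto
  have "real (card L) * d \<le> (\<Sum>y\<in>L. real (card (M x \<inter> N y)))"
    using sum_mono[of L "\<lambda>_. d" "\<lambda>y. real (card (M x \<inter> N y))"] by (simp add: L_def)
  also have "\<dots> \<le> M_edges x"
    unfolding M_edges_def using fM by (intro sum_mono2) (auto simp: L_def)
  finally have "real (card L) \<le> M_edges x / d" using d by (simp add: field_simps)
  moreover have "real (card (M x - L)) \<le> real m * (d + 1)"
  proof (rule few_of_small_degree)
    show "M x - L \<subseteq> V" using M_subset by auto
    fix y assume y: "y \<in> M x - L"
    have "card ((M x - L) \<inter> N y) \<le> card (M x \<inter> N y)" using fM by (intro card_mono) auto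
    then show "real (card ((M x - L) \<inter> N y)) \<le> d" using y by (auto simp: L_def)
  qed (use d in simp)
  moreover have "card (M x) = card L + card (M x - L)"
    using fM by (metis (no_types, lifting) L_def card_Diff_subset card_mono finite_subset
        le_add_diff_inverse mem_Collect_eq subsetI)
  ultimately show ?thesis by simp
qed

section \<open>Choice of parameters and the contradiction\<close>

text \<open>At least half of the vertices have \<open>n / (3 * m)\<close> or more non-neighbours. By
  averaging, one of them has so few edges among its non-neighbours that \<open>card_M_le\<close>
  contradicts this size.\<close>

lemma card_lt:
  assumes m6: "6 \<le> m"
  shows "real (card V) < real m ^ 13 * t"
proof (rule ccontr)
  let ?n = "real (card V)" and ?m = "real m"
  assume "\<not> ?thesis"
  then have n: "?m ^ 13 * t \<le> ?n" by simp
  \<comment> \<open>The estimates below need \<open>n\<close> to be only a large constant times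
    \<open>m ^ 6 * t\<close>. The other seven factors \<open>m\<close> pay for the constant:
    \<open>6 ^ 7 = 279936\<close>.\<close>
  have m7: "279936 \<le> ?m ^ 7" using power_mono[of 6 ?m 7] m6 by simp
  have m1: "1 \<le> ?m" using m_ge_1 by simp
  have "279936 * (?m ^ 6 * t) \<le> ?m ^ 7 * (?m ^ 6 * t)"
    using m7 t_ge_1 by (intro mult_right_mono) auto
  also have "\<dots> = ?m ^ 13 * t" by (simp add: power_add[of _ 7 6, simplified])
  finally have n6: "279936 * (?m ^ 6 * t) \<le> ?n" using n by linarith
  have m5: "?m ^ 5 * t \<le> ?m ^ 6 * t"
    using m1 t_ge_1 by (intro mult_right_mono power_increasing) auto
  have "?m ^ 2 * 1 \<le> ?m ^ 6 * t"
    using m1 t_ge_1 by (intro mult_mono power_increasing) auto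
  then have m2: "?m ^ 2 \<le> ?m ^ 6 * t" by simp
  have "?m \<le> ?m ^ 2" using m1 by (simp add: power2_eq_square)
  moreover have "1 \<le> ?m ^ 2" using m1 by simp
  ultimately have npos: "0 < ?n" and mn: "?m \<le> ?n / 6" using n6 m2 by linarith+
  \<comment> \<open>After multiplication by \<open>m ^ 3\<close>, the two terms of \<open>B\<close>
    with \<open>q\<close> become \<open>200 * m ^ 6 * t\<close> and \<open>n / 200\<close>. The
    choice of \<open>d\<close> makes \<open>m * (m * d)\<close> equal to
    \<open>n / 8\<close>.\<close>
  define q where "q = ?n / (200 * ?m ^ 3)"
  define B where "B = ?n * t / q + (q + 9 * ?m ^ 2 * t)"
  define d where "d = ?n / (8 * ?m ^ 2)"
  have q: "0 < q" and d: "0 < d" using npos m1 by (auto simp: q_def d_def)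
  define H where "H = {x \<in> V. ?n / (3 * ?m) \<le> real (card (M x))}"
  have fH: "finite H" "H \<subseteq> V" using fin_V by (auto simp: H_def)
  \<comment> \<open>The 3 in \<open>H\<close> leaves room: \<open>V - H\<close> has at most
    \<open>n / 3 + m \<le> n / 2\<close> vertices.\<close>
  have "real (card (V - H)) \<le> ?m * (?n / (3 * ?m) + 1)"
  proof (rule few_of_small_codegree)
    fix x assume x: "x \<in> V - H"
    have "card ((V - H) \<inter> M x) \<le> card (M x)"
      using finite_subset_V[OF M_subset] by (intro card_mono) auto
    then show "real (card ((V - H) \<inter> M x)) \<le> ?n / (3 * ?m)" using x by (auto simp: H_def)
  qed (use npos in simp_all)
  also have "\<dots> = ?n / 3 + ?m" using m1 by (simp add: field_simps)
  finally have cH: "?n / 2 \<le> real (card H)"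
    using mn card_Diff_ge[of V H] fH by (simp add: Int_absorb1)
  have "\<exists>x\<in>H. M_edges x \<le> 2 * ?n * B"
  proof (rule ccontr)
    assume "\<not> ?thesis"
    then have gt: "2 * ?n * B < M_edges x" if "x \<in> H" for x using that by auto
    have "H \<noteq> {}" using cH npos by auto
    have "?n ^ 2 * B = ?n / 2 * (2 * ?n * B)" by (simp add: power2_eq_square)
    also have "\<dots> \<le> real (card H) * (2 * ?n * B)"
      using cH npos q t_ge_1 by (intro mult_right_mono) (auto simp: B_def)
    also have "\<dots> < (\<Sum>x\<in>H. M_edges x)"
      using sum_strict_mono[OF fH(1) \<open>H \<noteq> {}\<close>, of "\<lambda>_. 2 * ?n * B" M_edges] gt by simp
    also have "\<dots> \<le> (\<Sum>x\<in>V. M_edges x)"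
      using fH fin_V by (intro sum_mono2) (auto simp: M_edges_def sum_nonneg)
    also have "\<dots> \<le> ?n ^ 2 * B" unfolding B_def by (rule sum_M_edges_le[OF q])
    finally show False by simp
  qed
  then obtain x where x: "x \<in> H" "M_edges x \<le> 2 * ?n * B" by blast
  have "?n / (3 * ?m) \<le> M_edges x / d + ?m * (d + 1)"
    using x(1) card_M_le[OF d, of x] by (auto simp: H_def)
  also have "\<dots> \<le> 2 * ?n * B / d + ?m * (d + 1)"
    using x(2) d by (simp add: divide_right_mono)
  also have "\<dots> = 16 * ?m ^ 2 * B + ?n / (8 * ?m) + ?m"
    using npos m1 by (simp add: d_def field_simps power2_eq_square)
  \<comment> \<open>Multiplied by \<open>m\<close>, the left side is \<open>n / 3\<close>. On the
    right, \<open>n / 8\<close> and \<open>16 * n / 200\<close> make less than \<open>n / 4\<close>,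
    and the terms in \<open>m ^ 6 * t\<close>, \<open>m ^ 5 * t\<close> and \<open>m ^ 2\<close>
    make less than \<open>n / 12\<close>.\<close>
  finally have "?m * (?n / (3 * ?m)) \<le> ?m * (16 * ?m ^ 2 * B + ?n / (8 * ?m) + ?m)"
    using m1 by (intro mult_left_mono) auto
  moreover have "?m * (?n / (3 * ?m)) = ?n / 3" using m1 by simp
  moreover have "?m * (16 * ?m ^ 2 * B + ?n / (8 * ?m) + ?m) = 16 * (?m ^ 3 * B) + ?n / 8 + ?m ^ 2"
    using m1 by (simp add: algebra_simps power2_eq_square power3_eq_cube)
  moreover have "?m ^ 3 * B = 200 * (?m ^ 6 * t) + ?n / 200 + 9 * (?m ^ 5 * t)"
  proof -
    have "?n * t / q = 200 * ?m ^ 3 * t" using npos m1 by (simp add: q_def field_simps)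
    then have "?m ^ 3 * B = ?m ^ 3 * (200 * ?m ^ 3 * t) + ?m ^ 3 * q + ?m ^ 3 * (9 * ?m ^ 2 * t)"
      by (simp add: B_def algebra_simps)
    moreover have "?m ^ 3 * q = ?n / 200" using m1 by (simp add: q_def)
    moreover have "?m ^ 3 * ?m ^ 3 = ?m ^ 6" "?m ^ 3 * ?m ^ 2 = ?m ^ 5"
      by (simp_all flip: power_add)
    ultimately show ?thesis by (simp add: algebra_simps)
  qed
  ultimately show False using n6 m5 m2 npos by linarith
qed

end

section \<open>Reduction of the theorem to the locale\<close>

theorem theorem1p3:
  fixes V :: "'a set" and E :: "'a set set" and n m :: nat
  assumes "finite_simple_graph V E"
    and "card V = n"
    and "\<not> contains_induced V E (path_verts 5) (path_edges 5)"
    and "m = hom_number V E"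
    and "m < n"
  shows "\<exists>A B. A \<subseteq> V \<and> B \<subseteq> V \<and> A \<inter> B = {} \<and>
           real (card A) \<ge> real n / real m ^ 13 \<and>
           real (card B) \<ge> real n / real m ^ 13 \<and>
           (\<forall>a\<in>A. \<forall>b\<in>B. {a, b} \<notin> E)"
proof (rule ccontr)
  assume no: "\<not> ?thesis"
  let ?adj = "\<lambda>u v. {u, v} \<in> E"
  have fin: "finite V" and E: "E \<subseteq> [V]\<^bsup>2\<^esup>"
    using assms(1) by (auto simp: finite_simple_graph_def)
  have irrefl: "{v} \<notin> E" for v using subsetD[OF E, of "{v}"] by (auto simp: nsets_def)
  have hom: "card S \<le> m" if "S \<subseteq> V" "homogeneous S E" for S
  proof -
    have "finite {card S |S. S \<subseteq> V \<and> homogeneous S E}"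
      using fin by (auto intro: finite_subset[of _ "card ` Pow V"])
    then show ?thesis unfolding assms(4) hom_number_def using that by (intro Max_ge) auto
  qed
  have clique: "card S \<le> m" if "S \<subseteq> V" "pairwise ?adj S" for S
    using that hom[of S] by (auto simp: homogeneous_def clique_def pairwise_def)
  have indep: "card S \<le> m" if "S \<subseteq> V" "pairwise (\<lambda>u v. \<not> ?adj u v) S" for S
    using that hom[of S] by (auto simp: homogeneous_def indep_def pairwise_def)
  have symp: "symp ?adj" by (auto simp: symp_def insert_commute)
  \<comment> \<open>Since \<open>m < n\<close>, \<open>V\<close> is not a clique. A non-adjacent
    pair gives \<open>2 \<le> m\<close> and also settles the case \<open>n \<le> m ^ 13\<close>,
    where two singletons are large enough.\<close>
  have "\<not> pairwise ?adj V" using clique[of V] assms(2,5) by auto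
  then obtain a b where ab: "a \<in> V" "b \<in> V" "a \<noteq> b" "{a, b} \<notin> E" by (auto simp: pairwise_def)
  have "card {a, b} \<le> m" using ab by (intro indep) (auto simp: pairwise_def insert_commute)
  then have m2: "2 \<le> m" using ab by simp
  have n13: "real m ^ 13 < real n"
  proof (rule ccontr)
    assume "\<not> ?thesis"
    then have "real n / real m ^ 13 \<le> 1" using m2 by (simp add: divide_le_eq)
    then show False using no ab by (elim notE, intro exI[of _ "{a}"] exI[of _ "{b}"]) auto
  qed
  \<comment> \<open>Now \<open>n\<close> exceeds \<open>2 ^ 13\<close>, enough for Ramsey to give a
    homogeneous set of six vertices.\<close>
  have "(2::nat) ^ 13 \<le> m ^ 13" using m2 by (intro power_mono) auto
  moreover have "m ^ 13 < n" using n13 by (simp flip: of_nat_power)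
  ultimately have "2 ^ (6 + 6) \<le> card V" using assms(2) by simp
  then have m6: "6 \<le> m"
    using ramsey_two_power[OF fin symp, of 6 6] clique indep by metis
  interpret counterexample V ?adj m "real n / real m ^ 13"
  proof
    show "1 \<le> real n / real m ^ 13" using n13 m2 by (simp add: le_divide_eq)
    show "1 \<le> m" using m2 by simp
    show "real (card A) < real n / real m ^ 13 \<or> real (card B) < real n / real m ^ 13"
      if "A \<subseteq> V" "B \<subseteq> V" "A \<inter> B = {}" "\<And>a b. \<lbrakk>a \<in> A; b \<in> B\<rbrakk> \<Longrightarrow> {a, b} \<notin> E" for A B
      using no that by (meson linorder_not_le)
    show "{a, c} \<in> E \<or> {a, d} \<in> E \<or> {a, e} \<in> E \<or> {b, d} \<in> E \<or> {b, e} \<in> E \<or> {c, e} \<in> E"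
      if V: "a \<in> V" "b \<in> V" "c \<in> V" "d \<in> V" "e \<in> V"
        and adj: "{a, b} \<in> E" "{b, c} \<in> E" "{c, d} \<in> E" "{d, e} \<in> E" for a b c d e
    proof (rule ccontr)
      assume non: "\<not> ?thesis"
      let ?f = "\<lambda>i::nat. [a, b, c, d, e] ! i"
      have W: "path_verts 5 = {0, 1, 2, 3, 4}" by (auto simp: path_verts_def)
      have F: "path_edges 5 = {{0, 1}, {1, 2}, {2, 3}, {3, 4}}"
      proof -
        have "Suc i < 5 \<longleftrightarrow> i = 0 \<or> i = 1 \<or> i = 2 \<or> i = 3" for i by auto
        then show ?thesis by (auto simp: path_edges_def eval_nat_numeral)
      qed
      have "distinct [a, b, c, d, e]"
        using adj non irrefl by (auto simp: insert_commute)
      then have "inj_on ?f (path_verts 5)"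
        by (intro inj_on_nth) (auto simp: path_verts_def)
      moreover have "?f ` path_verts 5 \<subseteq> V" using V by (simp add: W)
      moreover have "\<forall>i\<in>path_verts 5. \<forall>j\<in>path_verts 5. {?f i, ?f j} \<in> E \<longleftrightarrow> {i, j} \<in> path_edges 5"
        using adj non irrefl by (simp add: W F insert_commute doubleton_eq_iff)
      ultimately show False using assms(3) unfolding contains_induced_def by blast
    qed
  qed (use fin irrefl clique indep in \<open>auto simp: insert_commute\<close>)
  \<comment> \<open>With \<open>t = n / m ^ 13\<close> the bound reads \<open>n < n\<close>.\<close>
  show False using card_lt[OF m6] assms(2) m2 by simp
qed

end
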